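(* (i) For every integer $n\ge 0$ and each $\xi\in\{2,3\}$, $$\overline{R}_4^{\ast}(4n+\xi)\equiv 0\pmod 4.$$ (ii) Let $p\ge 13$ be a prime with $\left(\frac{-6}{p}\right)=-1$ and let $1\le r\le p-1$ be an integer. Then for any integers $\alpha\ge 0$ and $n\ge 0$, $$\sum_{m=0}^{\infty}\overline{R}_4^{\ast}\left(4p^{2\alpha}m+\frac{7p^{2\alpha}-1}{6}\right)q^m\equiv 2f_1\psi(q^2)\pmod 4$$ and $$\overline{R}_4^{\ast}\left(4p^{2\alpha+1}(pn+r)+\frac{7p^{2\alpha+2}-1}{6}\right)\equiv 0\pmod 4.$$
   Context: An overpartition of a nonnegative integer $n$ is a partition of $n$ in which the first occurrence of each part size may be overlined. For a positive integer $\ell$, $\overline{R}_\ell^{\ast}(n)$ denotes the number of overpartitions of $n$ in which the non-overlined parts are $\ell$-regular, i.e. no non-overlined part is divisible by $\ell$ (overlined parts are unrestricted). For a positive integer $h$, $f_h:=(q^h;q^h)_\infty=\prod_{m\ge 1}(1-q^{hm})$. The generating function is $\sum_{n\ge 0}\overline{R}_\ell^{\ast}(n)q^n=\frac{f_2f_\ell}{f_1^2}$. Ramanujan's theta function is $\psi(q):=\sum_{\nu\ge 0}q^{\nu(\nu+1)/2}=\frac{f_2^2}{f_1}$. A congruence between power series in $q$ modulo an integer means congruence of all corresponding coefficients. $\left(\frac{\cdot}{p}\right)$ is the Legendre symbol. *)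

theory Defs
  imports
    "HOL-Analysis.Analysis"
    "HOL-Number_Theory.Number_Theory"
    "HOL-Library.Multiset"
    "HOL-Computational_Algebra.Formal_Power_Series"
begin

text \<open>
  As at most one occurrence of each part size can be overlined, an overpartition is given by the
  multiset \<open>M\<close> of all its parts together with the set \<open>S\<close> of those part sizes whose first
  occurrence is overlined. The multiset of its non-overlined parts is then \<open>M - mset_set S\<close>.
\<close>

definition overpartitions :: "nat \<Rightarrow> (nat multiset \<times> nat set) set" where
  "overpartitions n = {(M, S). (\<forall>x\<in>#M. 0 < x) \<and> sum_mset M = n \<and> S \<subseteq> set_mset M}"

definition overlined_parts :: "nat multiset \<times> nat set \<Rightarrow> nat multiset" where
  "overlined_parts P = mset_set (snd P)"

definition nonoverlined_parts :: "nat multiset \<times> nat set \<Rightarrow> nat multiset" where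
  "nonoverlined_parts P = fst P - overlined_parts P"

definition R_star :: "nat \<Rightarrow> nat \<Rightarrow> nat" where
  "R_star l n = card {P \<in> overpartitions n. \<forall>x\<in>#nonoverlined_parts P. \<not> l dvd x}"

text \<open>The product and the sum below converge in the \<open>q\<close>-adic metric on formal power series.\<close>

definition euler_f :: "nat \<Rightarrow> int fps" where
  "euler_f h = (\<Prod>m. 1 - fps_X ^ (h * Suc m))"

definition ramanujan_psi :: "int fps" where
  "ramanujan_psi = (\<Sum>\<nu>. fps_X ^ (\<nu> * (\<nu> + 1) div 2))"

definition fps_cong :: "int fps \<Rightarrow> int fps \<Rightarrow> int \<Rightarrow> bool" where
  "fps_cong A B k \<longleftrightarrow> (\<forall>n. [fps_nth A n = fps_nth B n] (mod k))"

lemma finite_overpartitions: "finite (overpartitions n)"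
proof -
  have fin: "finite {xs :: nat list. set xs \<subseteq> {..n} \<and> length xs \<le> n}"
    by (rule finite_lists_length_le) simp
  have "overpartitions n \<subseteq>
      (mset ` {xs :: nat list. set xs \<subseteq> {..n} \<and> length xs \<le> n}) \<times> Pow {..n}"
  proof
    fix P assume "P \<in> overpartitions n"
    then obtain M S where P: "P = (M, S)" and pos: "\<And>x. x \<in># M \<Longrightarrow> 0 < x"
      and sm: "sum_mset M = n" and S: "S \<subseteq> set_mset M"
      by (auto simp: overpartitions_def)
    have "size M \<le> sum_mset M" using pos
    proof (induction M)
      case (add x M)
      have "0 < x" using add.prems by simp
      moreover have "size M \<le> sum_mset M" using add.prems by (intro add.IH) simp
      ultimately show ?case by simp
    qed simp
    moreover have le: "set_mset M \<subseteq> {..n}"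
      using sm by (auto dest: multi_member_split)
    moreover obtain xs where "mset xs = M" using ex_mset by blast
    ultimately have "M \<in> mset ` {xs :: nat list. set xs \<subseteq> {..n} \<and> length xs \<le> n}"
      using sm by (intro image_eqI[of _ _ xs]) (auto simp flip: size_mset)
    then show "P \<in> (mset ` {xs :: nat list. set xs \<subseteq> {..n} \<and> length xs \<le> n}) \<times> Pow {..n}"
      using P S le by auto
  qed
  then show ?thesis using fin by (meson finite_SigmaI finite_Pow_iff finite_atMost finite_imageI finite_subset)
qed

lemma has_prod_euler_f:
  assumes "0 < h"
  shows "(\<lambda>m. 1 - fps_X ^ (h * Suc m) :: int fps) has_prod euler_f h"
proof -
  let ?g = "\<lambda>m. 1 - fps_X ^ (h * Suc m) :: int fps"
  let ?P = "\<lambda>n. \<Prod>m\<le>n. ?g m"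
  have step: "fps_nth (?P (Suc n)) k = fps_nth (?P n) k" if "k \<le> n" for n k
  proof -
    have "Suc (Suc n) \<le> h * Suc (Suc n)" using assms by (cases h) (simp_all only: mult_Suc le_add1 less_irrefl)
    then have "k < h * Suc (Suc n)" using that by linarith
    moreover have "?P (Suc n) = ?P n - ?P n * fps_X ^ (h * Suc (Suc n))"
      by (simp only: prod.atMost_Suc right_diff_distrib mult_1_right)
    ultimately show ?thesis by (simp only: fps_sub_nth fps_X_power_mult_right_nth if_True diff_zero)
  qed
  have stable: "fps_nth (?P n) k = fps_nth (?P k) k" if "k \<le> n" for n k
    using that by (induction n rule: dec_induct) (simp_all only: step)
  define L where "L = Abs_fps (\<lambda>k. fps_nth (?P k) k)"
  have lim: "?P \<longlonglongrightarrow> L"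
    unfolding tendsto_fps_iff
  proof
    fix k show "eventually (\<lambda>n. fps_nth (?P n) k = fps_nth L k) sequentially"
      using eventually_ge_at_top[of k] by eventually_elim (unfold L_def fps_nth_Abs_fps, rule stable)
  qed
  have "fps_nth L 0 = 1" using assms by (simp add: L_def fps_X_power_nth del: power_Suc)
  then have "L \<noteq> 0" by force
  with lim have "?g has_prod L" by (simp add: has_prod_def raw_has_prod_def)
  moreover from this have "L = euler_f h" unfolding euler_f_def by (rule has_prod_unique)
  ultimately show ?thesis by simp
qed

lemma ramanujan_psi_sums:
  "(\<lambda>\<nu>. fps_X ^ (\<nu> * (\<nu> + 1) div 2) :: int fps) sums ramanujan_psi"
proof -
  let ?t = "\<lambda>\<nu>::nat. \<nu> * (\<nu> + 1) div 2"
  have ge: "\<nu> \<le> ?t \<nu>" for \<nu> by (cases \<nu>) auto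
  have stable: "fps_nth (\<Sum>\<nu><n. fps_X ^ ?t \<nu> :: int fps) k =
      fps_nth (\<Sum>\<nu><Suc k. fps_X ^ ?t \<nu>) k" if "Suc k \<le> n" for n k
    using that
  proof (induction n rule: dec_induct)
    case (step n)
    have "k \<noteq> ?t n" using step(1) ge[of n] by linarith
    then have "fps_nth (fps_X ^ ?t n :: int fps) k = 0" by (simp only: fps_X_power_nth if_False)
    with step.IH show ?case by (simp only: sum.lessThan_Suc[of _ n] fps_add_nth add_0_right)
  qed simp
  define L where "L = Abs_fps (\<lambda>k. fps_nth (\<Sum>\<nu><Suc k. fps_X ^ ?t \<nu> :: int fps) k)"
  have "(\<lambda>\<nu>. fps_X ^ ?t \<nu> :: int fps) sums L"
    unfolding sums_def tendsto_fps_iff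
  proof
    fix k show "eventually (\<lambda>n. fps_nth (\<Sum>\<nu><n. fps_X ^ ?t \<nu> :: int fps) k = fps_nth L k) sequentially"
      using eventually_ge_at_top[of "Suc k"]
      by eventually_elim (unfold L_def fps_nth_Abs_fps, rule stable)
  qed
  then show ?thesis unfolding ramanujan_psi_def by (simp only: sums_iff)
qed

text \<open>For primes \<open>p \<ge> 5\<close>, both the subtraction and the division in \<open>(7 * p ^ (2 * k) - 1) div 6\<close> are exact.\<close>

lemma six_dvd_seven_power_diff:
  assumes "prime (p::nat)" "5 \<le> p"
  shows "6 dvd 7 * p ^ (2 * k) - 1"
proof -
  have "\<not> 2 dvd p" "\<not> 3 dvd p"
    using assms primes_dvd_imp_eq[of 2 p] primes_dvd_imp_eq[of 3 p] by auto
  then have "p mod 6 = 1 \<or> p mod 6 = 5" by presburger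
  then have "p ^ 2 mod 6 = 1" using power_mod[of p 6 2] by auto
  then have "[p ^ 2 = 1] (mod 6)" by (simp add: cong_def)
  then have "[(p ^ 2) ^ k = 1 ^ k] (mod 6)" by (rule cong_pow)
  then have "p ^ (2 * k) mod 6 = 1" by (simp add: cong_def power_mult)
  then show ?thesis by presburger
qed

end

theory Submission
  imports Defs "HOL-Computational_Algebra.Formal_Laurent_Series"
begin

text \<open>
  An overpartition is a multiset \<open>M\<close> of parts with a set \<open>S\<close> of overlined sizes. For a fixed \<open>M\<close>
  the number of admissible \<open>S\<close> is \<open>0\<close> if some multiple of \<open>l\<close> is repeated, and otherwise \<open>2 ^ c\<close>, where
  \<open>c\<close> counts the sizes not divisible by \<open>l\<close>: those may be overlined freely, while the multiples of
  \<open>l\<close> must be. Modulo \<open>4\<close>, for \<open>n\<close> not divisible by \<open>l\<close>, only the \<open>M\<close> with \<open>c = 1\<close> survive, each with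
  weight \<open>2\<close>. Such an \<open>M\<close> consists of a set \<open>l E\<close> of distinct multiples of \<open>l\<close> and of copies of one
  divisor of \<open>n - l \<Sum>E\<close>. As the number of divisors is odd exactly for squares,
  \<open>R_star l n\<close> is congruent to twice the number of sets \<open>E\<close> for which \<open>n - l \<Sum>E\<close> is a square
  (\<open>R_star_cong_square\<close>). For \<open>l = 4\<close> this settles the residues \<open>2\<close> and \<open>3\<close>, since squares are \<open>0\<close> or \<open>1\<close>
  modulo \<open>4\<close>, and for \<open>n = 4 m + 1\<close> it compares \<open>R_star 4 n\<close> with twice the \<open>m\<close>-th coefficient of
  \<open>f\<^sub>1 \<psi>(q\<^sup>2)\<close> (\<open>R_star_4_residue_1\<close>): the odd squares \<open>(2 \<nu> + 1)\<^sup>2\<close> supply \<open>\<psi>(q\<^sup>2)\<close>, and modulo \<open>2\<close> the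
  product \<open>f\<^sub>1\<close> counts partitions into distinct parts.

  The pentagonal number theorem, obtained from Shanks' finite identity (\<open>shanks_identity\<close>), says that
  the \<open>k\<close>-th coefficient of \<open>f\<^sub>1\<close> is odd exactly if \<open>24 k + 1\<close> is a square. Since
  \<open>24 \<nu> (\<nu> + 1) + 6 = 6 (2 \<nu> + 1)\<^sup>2\<close>, the \<open>m\<close>-th coefficient of \<open>f\<^sub>1 \<psi>(q\<^sup>2)\<close> has the parity of the
  number of pairs of natural numbers with \<open>x\<^sup>2 + 6 y\<^sup>2 = 24 m + 7\<close> (\<open>f1_psi_coeff_parity\<close>).
  If \<open>- 6\<close> is a quadratic non-residue modulo \<open>p\<close>, then \<open>p\<close> divides \<open>x\<^sup>2 + 6 y\<^sup>2\<close> only if it divides both \<open>x\<close>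
  and \<open>y\<close>. Hence multiplying the represented number by \<open>p\<^sup>2\<close> does not change the number of
  representations, and a number in which the exponent of \<open>p\<close> is odd has none. The first fact gives the
  congruence with \<open>2 f\<^sub>1 \<psi>(q\<^sup>2)\<close>, the second the vanishing along the progressions with \<open>1 \<le> r < p\<close>.
\<close>

section \<open>Shanks' finite form of the pentagonal number theorem\<close>

text \<open>The summand is \<open>(-1)\<^sup>s (P\<^sub>n / P\<^sub>s) x\<^bsup>s n + s (s + 1) / 2\<^esup>\<close> with \<open>P\<^sub>n = \<Prod>k=1..n. 1 - x\<^sup>k\<close>; writing the
  quotient as a product avoids division in the ring. For \<open>s = 0\<close> it is \<open>P\<^sub>n\<close>, and every other summand
  is divisible by \<open>x\<^bsup>n + 1\<^esup>\<close>.\<close>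

definition shanks_term :: "'a::comm_ring_1 \<Rightarrow> nat \<Rightarrow> nat \<Rightarrow> 'a" where
  "shanks_term x n s = (- 1) ^ s * (\<Prod>k\<in>{Suc s..n}. 1 - x ^ k) * x ^ (s * n + s * (s + 1) div 2)"

lemma triangular_Suc: "Suc s * (Suc s + 1) div 2 = s * (s + 1) div 2 + Suc s"
proof -
  have "Suc s * (Suc s + 1) = s * (s + 1) + Suc s * 2" by (simp add: algebra_simps)
  then show ?thesis by simp
qed

lemma shanks_term_Suc_left:
  assumes "s \<le> n"
  shows "shanks_term x (Suc n) s = (1 - x ^ Suc n) * x ^ s * shanks_term x n s"
proof -
  have "{Suc s..Suc n} = insert (Suc n) {Suc s..n}" using assms by auto
  then show ?thesis
    by (simp add: shanks_term_def power_add algebra_simps del: power_Suc)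
qed

text \<open>The exponent \<open>s n + s (s + 1) / 2\<close> grows by exactly \<open>n + 1 + s\<close> from \<open>s\<close> to \<open>s + 1\<close>; this is what lets the
  sums for consecutive \<open>n\<close> telescope.\<close>

lemma shanks_term_Suc_right:
  assumes "s < n"
  shows "x ^ (Suc n + s) * shanks_term x n s = - (1 - x ^ Suc s) * shanks_term x n (Suc s)"
proof -
  have 1: "{Suc s..n} = insert (Suc s) {Suc (Suc s)..n}" using assms by auto
  have 2: "Suc s * n + Suc s * (Suc s + 1) div 2 = s * n + s * (s + 1) div 2 + (Suc n + s)"
    unfolding triangular_Suc by simp
  show ?thesis
    unfolding shanks_term_def 2 power_add[of x "s * n + s * (s + 1) div 2" "Suc n + s"] 1
    by (simp add: algebra_simps del: mult_Suc add_Suc)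
qed

definition pentagonal :: "int \<Rightarrow> nat" where
  "pentagonal j = nat (j * (3 * j - 1) div 2)"

text \<open>Completing the square makes pentagonal numbers comparable without dividing, and shows that
  \<open>j\<close> is determined by its pentagonal number.\<close>

lemma pentagonal_square: "int (24 * pentagonal j + 1) = (6 * j - 1) ^ 2"
proof -
  have "even (j * (3 * j - 1))" by auto
  moreover have "0 \<le> j * (3 * j - 1)"
    by (cases "j \<le> 0") (auto intro: mult_nonneg_nonneg mult_nonpos_nonpos)
  ultimately have "int (pentagonal j) * 2 = j * (3 * j - 1)"
    by (simp add: pentagonal_def)
  then have "24 * int (pentagonal j) = 12 * (j * (3 * j - 1))" by simp
  then show ?thesis by (simp add: power2_eq_square algebra_simps)
qed

lemma pentagonal_eqI: "24 * int k + 1 = (6 * j - 1) ^ 2 \<Longrightarrow> pentagonal j = k"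
  using pentagonal_square[of j] by simp

text \<open>The recurrences above turn the sum for \<open>n + 1\<close> into the sum for \<open>n\<close> up to two boundary terms, and
  these are the two new pentagonal powers, for \<open>j = n + 1\<close> and \<open>j = - (n + 1)\<close>.\<close>

theorem shanks_identity:
  fixes x :: "'a::comm_ring_1"
  shows "(\<Sum>s\<le>n. shanks_term x n s) = (\<Sum>j\<in>{- int n..int n}. (- 1) ^ nat \<bar>j\<bar> * x ^ pentagonal j)"
proof (induction n)
  case 0
  then show ?case by (simp add: shanks_term_def pentagonal_def)
next
  case (Suc n)
  let ?T = "shanks_term x"
  have tri: "int (s * (s + 1) div 2) * 2 = int s * (int s + 1)" for s
    by (simp add: zdiv_int algebra_simps)
  have upper: "?T (Suc n) (Suc n) = (- 1) ^ Suc n * x ^ pentagonal (- int (Suc n))"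
  proof -
    have "pentagonal (- int (Suc n)) = Suc n * Suc n + Suc n * (Suc n + 1) div 2"
      using tri[of "Suc n"] by (intro pentagonal_eqI) (simp add: power2_eq_square algebra_simps)
    then show ?thesis by (simp add: shanks_term_def)
  qed
  have lower: "x ^ (Suc n + n) * ?T n n = (- 1) ^ n * x ^ pentagonal (int (Suc n))"
  proof -
    have "pentagonal (int (Suc n)) = (n * n + n * (n + 1) div 2) + (Suc n + n)"
      using tri[of n] by (intro pentagonal_eqI) (simp add: power2_eq_square algebra_simps)
    then show ?thesis by (simp add: shanks_term_def power_add algebra_simps)
  qed
  \<comment> \<open>The factor \<open>1 - x\<^bsup>n + 1\<^esup>\<close> relating the terms for \<open>n + 1\<close> and \<open>n\<close> splits the sum in two.
    Shifting the index in the part with \<open>x\<^bsup>n + 1\<^esup>\<close> makes it cancel against the other part.\<close>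
  have "(\<Sum>s\<le>n. x ^ (Suc n + s) * ?T n s)
      = (\<Sum>s<n. x ^ (Suc n + s) * ?T n s) + x ^ (Suc n + n) * ?T n n"
    by (simp add: lessThan_Suc_atMost[symmetric])
  also have "(\<Sum>s<n. x ^ (Suc n + s) * ?T n s) = - (\<Sum>s<n. (1 - x ^ Suc s) * ?T n (Suc s))"
    unfolding sum_negf[symmetric]
    by (intro sum.cong refl) (metis lessThan_iff mult_minus_left shanks_term_Suc_right)
  also have "(\<Sum>s<n. (1 - x ^ Suc s) * ?T n (Suc s)) = (\<Sum>s\<le>n. (1 - x ^ s) * ?T n s)"
    by (simp add: sum.atMost_shift)
  finally have shift: "(\<Sum>s\<le>n. x ^ (Suc n + s) * ?T n s)
      = x ^ (Suc n + n) * ?T n n - (\<Sum>s\<le>n. (1 - x ^ s) * ?T n s)" by simp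
  have "(\<Sum>s\<le>Suc n. ?T (Suc n) s) = (\<Sum>s\<le>n. (1 - x ^ Suc n) * x ^ s * ?T n s) + ?T (Suc n) (Suc n)"
    by (simp add: shanks_term_Suc_left del: power_Suc)
  also have "(\<Sum>s\<le>n. (1 - x ^ Suc n) * x ^ s * ?T n s)
      = (\<Sum>s\<le>n. x ^ s * ?T n s) - (\<Sum>s\<le>n. x ^ (Suc n + s) * ?T n s)"
    unfolding sum_subtractf[symmetric] by (intro sum.cong refl) (simp add: power_add algebra_simps)
  also have "\<dots> = (\<Sum>s\<le>n. ?T n s) - x ^ (Suc n + n) * ?T n n"
    unfolding shift by (simp add: left_diff_distrib sum_subtractf)
  finally have step: "(\<Sum>s\<le>Suc n. ?T (Suc n) s)
      = (\<Sum>s\<le>n. ?T n s) - x ^ (Suc n + n) * ?T n n + ?T (Suc n) (Suc n)" .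
  have "{- int (Suc n)..int (Suc n)} = insert (int (Suc n)) (insert (- int (Suc n)) {- int n..int n})"
    by auto
  then have "(\<Sum>j\<in>{- int (Suc n)..int (Suc n)}. (- 1) ^ nat \<bar>j\<bar> * x ^ pentagonal j)
      = (- 1) ^ Suc n * x ^ pentagonal (int (Suc n)) + ((- 1) ^ Suc n * x ^ pentagonal (- int (Suc n))
        + (\<Sum>j\<in>{- int n..int n}. (- 1) ^ nat \<bar>j\<bar> * x ^ pentagonal j))"
    by (simp add: nat_add_distrib del: of_nat_Suc)
  then show ?case unfolding step Suc.IH upper lower by simp
qed

text \<open>Requiring \<open>N \<ge> k\<close> allows both the comparison with Shanks' identity, where the error terms start in
  degree \<open>N + 1\<close>, and the expansion over all subsets of \<open>{1..N}\<close> with sum \<open>k\<close>.\<close>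

lemma fps_nth_euler_f_1:
  "\<exists>N\<ge>k. fps_nth (euler_f 1) k = fps_nth (\<Prod>m\<in>{1..N}. 1 - fps_X ^ m :: int fps) k"
proof -
  have "(\<lambda>n. \<Prod>m\<le>n. 1 - fps_X ^ (1 * Suc m) :: int fps) \<longlonglongrightarrow> euler_f 1"
    using has_prod_euler_f[of 1] by (intro has_prod_imp_tendsto) simp
  then have "eventually (\<lambda>n. fps_nth (\<Prod>m\<le>n. 1 - fps_X ^ (1 * Suc m) :: int fps) k = fps_nth (euler_f 1) k)
      sequentially"
    unfolding tendsto_fps_iff by blast
  then obtain n0 where n0: "\<And>n. n \<ge> n0 \<Longrightarrow>
      fps_nth (\<Prod>m\<le>n. 1 - fps_X ^ (1 * Suc m) :: int fps) k = fps_nth (euler_f 1) k"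
    unfolding eventually_sequentially by blast
  let ?n = "max n0 k"
  have "(\<Prod>m\<le>?n. 1 - fps_X ^ (1 * Suc m) :: int fps) = (\<Prod>m\<in>{1..Suc ?n}. 1 - fps_X ^ m)"
    by (rule prod.reindex_bij_witness[of _ "\<lambda>m. m - 1" Suc]) auto
  with n0[of ?n] have "fps_nth (euler_f 1) k = fps_nth (\<Prod>m\<in>{1..Suc ?n}. 1 - fps_X ^ m :: int fps) k"
    by simp
  then show ?thesis by (intro exI[of _ "Suc ?n"]) auto
qed

text \<open>Signs do not matter modulo \<open>2\<close>, so only the number of contributing terms does.\<close>

lemma fps_nth_sign_sum_parity:
  fixes g e :: "'b \<Rightarrow> nat"
  assumes "finite A"
  shows "even (fps_nth (\<Sum>a\<in>A. (- 1) ^ e a * fps_X ^ g a :: int fps) k - int (card {a \<in> A. g a = k}))"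
proof -
  have "fps_nth (\<Sum>a\<in>A. (- 1) ^ e a * fps_X ^ g a :: int fps) k
      = (\<Sum>a\<in>A. if g a = k then (- 1) ^ e a else 0)"
  proof -
    have "fps_nth ((- 1) ^ e a * fps_X ^ g a :: int fps) k = (if g a = k then (- 1) ^ e a else 0)" for a
      by (cases "even (e a)") (auto simp: fps_X_power_nth)
    then show ?thesis by (simp add: fps_sum_nth)
  qed
  moreover have "int (card {a \<in> A. g a = k}) = (\<Sum>a\<in>A. if g a = k then 1 else 0)"
    using assms by (simp add: sum.If_cases Int_def)
  ultimately have "fps_nth (\<Sum>a\<in>A. (- 1) ^ e a * fps_X ^ g a :: int fps) k - int (card {a \<in> A. g a = k})
      = (\<Sum>a\<in>A. if g a = k then (- 1) ^ e a - 1 else 0)"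
    by (simp add: sum_subtractf[symmetric] if_distrib cong: if_cong sum.cong)
  also have "even \<dots>" by (intro dvd_sum) auto
  finally show ?thesis .
qed

text \<open>Euler's pentagonal number theorem modulo \<open>2\<close>: as \<open>j\<close> is determined by its pentagonal number, at
  most one term contributes to each coefficient, and \<open>24 k + 1 = (6 j - 1)\<^sup>2\<close> for some integer \<open>j\<close> exactly if
  \<open>24 k + 1\<close> is a square, because its root is prime to \<open>6\<close>.\<close>

theorem euler_f_1_odd_iff: "odd (fps_nth (euler_f 1) k) \<longleftrightarrow> (\<exists>x::nat. x ^ 2 = 24 * k + 1)"
proof -
  obtain n where n: "k \<le> n" "fps_nth (euler_f 1) k = fps_nth (\<Prod>m\<in>{1..n}. 1 - fps_X ^ m :: int fps) k"
    using fps_nth_euler_f_1 by blast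
  have small: "fps_nth (shanks_term (fps_X :: int fps) n s) k = 0" if "0 < s" for s
  proof -
    have "n \<le> s * n" using that by simp
    moreover have "0 < s * (s + 1) div 2" using that by (cases s) auto
    ultimately have "k < s * n + s * (s + 1) div 2" using n(1) by linarith
    then show ?thesis unfolding shanks_term_def by (simp only: fps_X_power_mult_right_nth if_True)
  qed
  let ?A = "{j \<in> {- int n..int n}. pentagonal j = k}"
  have "fps_nth (euler_f 1) k = fps_nth (\<Sum>s\<le>n. shanks_term (fps_X :: int fps) n s) k"
    using n(2) by (simp add: fps_sum_nth sum.atMost_shift small) (simp add: shanks_term_def)
  then have "even (fps_nth (euler_f 1) k - int (card ?A))"
    unfolding shanks_identity using fps_nth_sign_sum_parity[of "{- int n..int n}" "\<lambda>j. nat \<bar>j\<bar>" pentagonal k]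
    by simp
  then have "odd (fps_nth (euler_f 1) k) \<longleftrightarrow> odd (card ?A)" by simp
  also have "\<dots> \<longleftrightarrow> ?A \<noteq> {}"
  proof
    assume "?A \<noteq> {}"
    then obtain j where j: "j \<in> ?A" by blast
    have "i = j" if "i \<in> ?A" for i
    proof -
      have "(6 * i - 1) ^ 2 = (6 * j - 1) ^ 2" using that j by (simp flip: pentagonal_square)
      then show ?thesis unfolding power2_eq_iff by presburger
    qed
    then have "?A = {j}" using j by blast
    then show "odd (card ?A)" by simp
  qed (metis card.empty even_zero)
  also have "\<dots> \<longleftrightarrow> (\<exists>x::nat. x ^ 2 = 24 * k + 1)"
  proof
    assume "?A \<noteq> {}"
    then obtain j where "pentagonal j = k" by blast
    then have "(nat \<bar>6 * j - 1\<bar>) ^ 2 = 24 * k + 1"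
      using pentagonal_square[of j] by (simp add: nat_abs_mult_distrib power2_eq_square flip: nat_mult_distrib) 
    then show "\<exists>x::nat. x ^ 2 = 24 * k + 1" by blast
  next
    assume "\<exists>x::nat. x ^ 2 = 24 * k + 1"
    then obtain x :: nat where x: "x ^ 2 = 24 * k + 1" by blast
    \<comment> \<open>The sign of \<open>6 j - 1\<close> is chosen by the residue of the root modulo \<open>6\<close>.\<close>
    have "x ^ 2 mod 6 = 1" unfolding x by presburger
    then have "(x mod 6) ^ 2 mod 6 = 1" by (simp add: power_mod)
    moreover have "x mod 6 \<in> {0,1,2,3,4,5}" by auto
    ultimately have "x mod 6 = 1 \<or> x mod 6 = 5" by auto
    then obtain j where j: "int x = 6 * j - 1 \<or> int x = - (6 * j - 1)"
    proof
      assume "x mod 6 = 1"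
      then have "int x = - (6 * (- int (x div 6)) - 1)" by presburger
      then show thesis using that by blast
    next
      assume "x mod 6 = 5"
      then have "int x = 6 * (int (x div 6) + 1) - 1" by presburger
      then show thesis using that by blast
    qed
    have sq: "24 * int k + 1 = (6 * j - 1) ^ 2"
      using j x by (metis of_nat_1 of_nat_add of_nat_mult of_nat_numeral of_nat_power power2_minus)
    then have "pentagonal j = k" by (rule pentagonal_eqI)
    moreover have "\<bar>j\<bar> \<le> int n"
    proof (rule ccontr)
      assume "\<not> \<bar>j\<bar> \<le> int n"
      then have "int k + 1 \<le> \<bar>j\<bar>" using n(1) by simp
      then have "\<bar>6 * int k + 5\<bar> \<le> \<bar>6 * j - 1\<bar>" by linarith
      then have "(6 * int k + 5) ^ 2 \<le> (6 * j - 1) ^ 2" by (simp only: abs_le_square_iff)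
      moreover have "0 \<le> int k * (int k * 36)" by simp
      ultimately show False unfolding sq[symmetric] by (simp add: power2_eq_square algebra_simps)
    qed
    ultimately have "j \<in> ?A" by auto
    then show "?A \<noteq> {}" by blast
  qed
  finally show ?thesis .
qed

section \<open>Counting overpartitions modulo 4\<close>

text \<open>The involution \<open>d \<mapsto> n / d\<close> pairs the divisors below the square root with those above it.\<close>

lemma divisor_count_odd_iff:
  fixes n :: nat
  assumes "0 < n"
  shows "odd (card {d. d dvd n}) \<longleftrightarrow> (\<exists>k. k ^ 2 = n)"
proof -
  let ?L = "{d. d dvd n \<and> d * d < n}" and ?G = "{d. d dvd n \<and> n < d * d}" and ?E = "{d. d * d = n}"
  have fin: "finite {d. d dvd n}" using assms by simp
  have fins: "finite ?L" "finite ?G" "finite ?E" by (rule finite_subset[OF _ fin]; auto)+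
  have "bij_betw (\<lambda>d. n div d) ?L ?G"
  proof (rule bij_betwI[where g = "\<lambda>d. n div d"])
    have cmp: "(n div d) * (n div d) < n \<longleftrightarrow> n < d * d" "n < (n div d) * (n div d) \<longleftrightarrow> d * d < n"
      if dvd: "d dvd n" for d
    proof -
      obtain e where e: "n = d * e" using dvd by blast
      with assms have "0 < d" "0 < e" by auto
      then show "(n div d) * (n div d) < n \<longleftrightarrow> n < d * d" "n < (n div d) * (n div d) \<longleftrightarrow> d * d < n"
        by (auto simp: e)
    qed
    show "(\<lambda>d. n div d) \<in> ?L \<rightarrow> ?G" "(\<lambda>d. n div d) \<in> ?G \<rightarrow> ?L" using cmp by auto
  qed (use assms in auto)
  then have card_eq: "card ?L = card ?G" by (rule bij_betw_same_card)
  have split: "{d. d dvd n} = (?L \<union> ?G) \<union> ?E" by auto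
  have "card {d. d dvd n} = card (?L \<union> ?G) + card ?E" unfolding split
    by (rule card_Un_disjoint[OF finite_UnI[OF fins(1,2)] fins(3)])
      (unfold disjoint_iff Un_iff mem_Collect_eq, metis less_irrefl)
  also have "card (?L \<union> ?G) = card ?L + card ?G"
    by (rule card_Un_disjoint[OF fins(1,2)]) (unfold disjoint_iff mem_Collect_eq, metis less_asym)
  finally have "card {d. d dvd n} = 2 * card ?L + card ?E" using card_eq by simp
  then have "odd (card {d. d dvd n}) \<longleftrightarrow> odd (card ?E)" by simp
  also have "\<dots> \<longleftrightarrow> ?E \<noteq> {}"
  proof
    assume "?E \<noteq> {}"
    then obtain d where d: "d * d = n" by blast
    have "e = d" if "e * e = n" for e
      using that d power2_eq_iff_nonneg[of e d] by (simp add: power2_eq_square)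
    then have "?E = {d}" using d by blast
    then show "odd (card ?E)" by simp
  qed (metis card.empty even_zero)
  finally show ?thesis by (auto simp: power2_eq_square)
qed

text \<open>These are the multisets of parts that admit at least one overlining counted by \<open>R_star l n\<close>: a
  repeated multiple of \<open>l\<close> would leave a non-overlined copy.\<close>

definition distinct_multiples_multisets :: "nat \<Rightarrow> nat \<Rightarrow> nat multiset set" where
  "distinct_multiples_multisets l n = {M. (\<forall>x\<in>#M. 0 < x) \<and> sum_mset M = n \<and> (\<forall>x\<in>#M. l dvd x \<longrightarrow> count M x = 1)}"

lemma finite_distinct_multiples_multisets: "finite (distinct_multiples_multisets l n)"
proof (rule finite_subset)
  show "distinct_multiples_multisets l n \<subseteq> fst ` overpartitions n"
    by (auto simp: distinct_multiples_multisets_def overpartitions_def image_iff)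
qed (simp add: finite_overpartitions)

lemma card_interval_Pow:
  assumes "finite D" "A \<subseteq> D"
  shows "card {S. A \<subseteq> S \<and> S \<subseteq> D} = 2 ^ card (D - A)"
proof -
  have "bij_betw (\<lambda>S. A \<union> S) (Pow (D - A)) {S. A \<subseteq> S \<and> S \<subseteq> D}"
    by (rule bij_betwI[where g = "\<lambda>S. S - A"]) (use assms in auto)
  then show ?thesis
    using bij_betw_same_card card_Pow[of "D - A"] assms by fastforce
qed

text \<open>Overlining removes a single copy, so a multiple of \<open>l\<close> disappears from the non-overlined parts only
  if it is overlined and occurs once.\<close>

lemma nonoverlined_regular_iff:
  assumes "S \<subseteq> set_mset M"
  shows "(\<forall>x\<in>#nonoverlined_parts (M, S). \<not> l dvd x) \<longleftrightarrow>
    {x \<in> set_mset M. l dvd x} \<subseteq> S \<and> (\<forall>x\<in>#M. l dvd x \<longrightarrow> count M x = 1)"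
proof -
  have fin: "finite S" using assms finite_subset by blast
  have mem: "x \<in># nonoverlined_parts (M, S) \<longleftrightarrow> (if x \<in> S then 1 else 0) < count M x" for x
    using fin by (auto simp: nonoverlined_parts_def overlined_parts_def simp flip: count_greater_zero_iff)
  have key: "\<not> (if x \<in> S then 1 else 0) < count M x \<longleftrightarrow> x \<in> S \<and> count M x = 1" if "x \<in># M" for x
    using that by (auto simp flip: count_greater_zero_iff)
  show ?thesis
  proof
    assume L: "\<forall>x\<in>#nonoverlined_parts (M, S). \<not> l dvd x"
    then have "x \<in> S \<and> count M x = 1" if "x \<in># M" "l dvd x" for x
      using that key[OF that(1)] mem by blast
    then show "{x \<in> set_mset M. l dvd x} \<subseteq> S \<and> (\<forall>x\<in>#M. l dvd x \<longrightarrow> count M x = 1)" by blast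
  next
    assume R: "{x \<in> set_mset M. l dvd x} \<subseteq> S \<and> (\<forall>x\<in>#M. l dvd x \<longrightarrow> count M x = 1)"
    show "\<forall>x\<in>#nonoverlined_parts (M, S). \<not> l dvd x"
    proof (intro ballI notI)
      fix x assume x: "x \<in># nonoverlined_parts (M, S)" "l dvd x"
      then have "x \<in># M" by (simp add: nonoverlined_parts_def in_diffD)
      with R x key mem show False by blast
    qed
  qed
qed

text \<open>For each multiset of parts, the multiples of \<open>l\<close> have to be overlined and the other sizes may be.\<close>

lemma R_star_eq_sum:
  "R_star l n = (\<Sum>M\<in>distinct_multiples_multisets l n. 2 ^ card {x \<in> set_mset M. \<not> l dvd x})"
proof -
  have "{P \<in> overpartitions n. \<forall>x\<in>#nonoverlined_parts P. \<not> l dvd x} =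
     (SIGMA M:distinct_multiples_multisets l n. {S. {x \<in> set_mset M. l dvd x} \<subseteq> S \<and> S \<subseteq> set_mset M})" (is "?A = ?B")
  proof (rule Set.set_eqI)
    fix P :: "nat multiset \<times> nat set"
    obtain M S where P: "P = (M, S)" by (cases P)
    show "P \<in> ?A \<longleftrightarrow> P \<in> ?B"
      using nonoverlined_regular_iff[of S M l] unfolding P
      by (auto simp: overpartitions_def distinct_multiples_multisets_def)
  qed
  then have "R_star l n
      = (\<Sum>M\<in>distinct_multiples_multisets l n. card {S. {x \<in> set_mset M. l dvd x} \<subseteq> S \<and> S \<subseteq> set_mset M})"
    unfolding R_star_def by (simp add: card_SigmaI finite_distinct_multiples_multisets)
  also have "\<dots> = (\<Sum>M\<in>distinct_multiples_multisets l n. 2 ^ card {x \<in> set_mset M. \<not> l dvd x})"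
  proof (intro sum.cong refl)
    fix M :: "nat multiset"
    have "set_mset M - {x \<in> set_mset M. l dvd x} = {x \<in> set_mset M. \<not> l dvd x}" by auto
    then show "card {S. {x \<in> set_mset M. l dvd x} \<subseteq> S \<and> S \<subseteq> set_mset M} = 2 ^ card {x \<in> set_mset M. \<not> l dvd x}"
      by (subst card_interval_Pow) auto
  qed
  finally show ?thesis .
qed

text \<open>Since \<open>l\<close> does not divide \<open>n\<close>, every exponent in \<open>R_star_eq_sum\<close> is positive, and \<open>2 ^ c\<close> vanishes
  modulo \<open>4\<close> from \<open>c = 2\<close> on.\<close>

lemma R_star_cong_single_nonmultiple:
  assumes "\<not> l dvd n"
  shows "[R_star l n = 2 * card {M \<in> distinct_multiples_multisets l n. \<exists>d. {x \<in> set_mset M. \<not> l dvd x} = {d}}] (mod 4)"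
proof -
  let ?c = "\<lambda>M. card {x \<in> set_mset M. \<not> l dvd x}"
  have pos: "0 < ?c M" if "M \<in> distinct_multiples_multisets l n" for M
  proof (rule ccontr)
    assume "\<not> 0 < ?c M"
    then have "\<forall>x\<in>#M. l dvd x" by auto
    then have "l dvd sum_mset M" by (induction M) auto
    with that assms show False by (simp add: distinct_multiples_multisets_def)
  qed
  have "[2 ^ ?c M = (if ?c M = 1 then 2 else 0 :: nat)] (mod 4)" if "M \<in> distinct_multiples_multisets l n" for M
  proof (cases "?c M = 1")
    case False
    then have "2 \<le> ?c M" using pos[OF that] by linarith
    then have "(2::nat) ^ 2 dvd 2 ^ ?c M" by (rule le_imp_power_dvd)
    then show ?thesis using False by (simp add: cong_0_iff)
  qed simp
  then have "[R_star l n = (\<Sum>M\<in>distinct_multiples_multisets l n. if ?c M = 1 then 2 else 0)] (mod 4)"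
    unfolding R_star_eq_sum by (rule cong_sum)
  also have "(\<Sum>M\<in>distinct_multiples_multisets l n. if ?c M = 1 then 2 else 0)
      = 2 * card {M \<in> distinct_multiples_multisets l n. ?c M = 1}"
    by (simp add: sum.If_cases finite_distinct_multiples_multisets Int_def)
  finally show ?thesis by (simp add: card_1_singleton_iff)
qed

definition distinct_partitions :: "nat \<Rightarrow> nat set set" where
  "distinct_partitions n = {E. finite E \<and> 0 \<notin> E \<and> \<Sum>E = n}"

lemma distinct_partitions_subset: "distinct_partitions n \<subseteq> Pow {1..n}"
proof
  fix E assume E: "E \<in> distinct_partitions n"
  have "x \<le> n" "1 \<le> x" if "x \<in> E" for x
    using E that member_le_sum[of x E "\<lambda>x. x"] by (auto simp: distinct_partitions_def Suc_le_eq intro: gr0I)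
  then show "E \<in> Pow {1..n}" by auto
qed

lemma finite_distinct_partitions [simp]: "finite (distinct_partitions n)"
  by (rule finite_subset[OF distinct_partitions_subset]) simp

definition compose_multiset :: "nat \<Rightarrow> nat \<Rightarrow> nat set \<Rightarrow> nat \<Rightarrow> nat multiset" where
  "compose_multiset l n E d = mset_set ((*) l ` E) + replicate_mset ((n - l * \<Sum>E) div d) d"

text \<open>A multiset with exactly one size \<open>d\<close> not divisible by \<open>l\<close> is determined by \<open>d\<close> and by the set \<open>E\<close> of
  its quotients by \<open>l\<close>, because the multiples of \<open>l\<close> occur once each and the total forces the
  multiplicity of \<open>d\<close>. Conversely a divisor \<open>d\<close> of \<open>n - l \<Sum>E\<close> cannot be a multiple of \<open>l\<close>.\<close>

lemma single_nonmultiple_bij: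
  assumes l: "\<not> l dvd n" "0 < l"
  shows "bij_betw (\<lambda>(E, d). compose_multiset l n E d)
    (SIGMA E:{E. finite E \<and> 0 \<notin> E \<and> l * \<Sum>E \<le> n}. {d. d dvd n - l * \<Sum>E})
    {M \<in> distinct_multiples_multisets l n. \<exists>d. {x \<in> set_mset M. \<not> l dvd x} = {d}}"
  (is "bij_betw ?f ?A ?B")
proof -
  have inj: "inj_on ((*) l) E" for E using l(2) by (simp add: inj_on_def)
  have compose_props: "compose_multiset l n E d \<in> distinct_multiples_multisets l n"
      "{x \<in> set_mset (compose_multiset l n E d). l dvd x} = (*) l ` E"
      "{x \<in> set_mset (compose_multiset l n E d). \<not> l dvd x} = {d}"
    if E: "finite E" "0 \<notin> E" "l * \<Sum>E \<le> n" and d: "d dvd n - l * \<Sum>E" for E d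
  proof -
    let ?c = "(n - l * \<Sum>E) div d"
    have ndvd: "\<not> l dvd n - l * \<Sum>E"
    proof
      assume "l dvd n - l * \<Sum>E"
      then have "l dvd (n - l * \<Sum>E) + l * \<Sum>E" by (rule dvd_add) simp
      then show False using l(1) E(3) by simp
    qed
    then have nl: "\<not> l dvd d" using d dvd_trans by blast
    have pos: "0 < n - l * \<Sum>E" using ndvd by (metis dvd_0_right gr0I)
    have d0: "0 < d" using nl by (metis dvd_0_right gr0I)
    have c0: "0 < ?c" using d pos by (metis dvd_div_eq_0_iff gr0I less_irrefl)
    have set: "set_mset (compose_multiset l n E d) = insert d ((*) l ` E)"
      using c0 E(1) by (auto simp: compose_multiset_def)
    show "{x \<in> set_mset (compose_multiset l n E d). l dvd x} = (*) l ` E"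
      "{x \<in> set_mset (compose_multiset l n E d). \<not> l dvd x} = {d}"
      unfolding set using nl by auto
    have "sum_mset (compose_multiset l n E d) = (\<Sum>x\<in>(*) l ` E. x) + ?c * d"
      by (simp add: compose_multiset_def sum_unfold_sum_mset)
    also have "\<dots> = l * \<Sum>E + ?c * d" by (simp add: sum.reindex[OF inj] sum_distrib_left)
    also have "\<dots> = n" using d E(3) by simp
    finally have sm: "sum_mset (compose_multiset l n E d) = n" .
    have "count (compose_multiset l n E d) x = 1" if "x \<in># compose_multiset l n E d" "l dvd x" for x
    proof -
      have "x \<in> (*) l ` E" "x \<noteq> d" using that nl unfolding set by auto
      then show ?thesis using E(1) by (simp add: compose_multiset_def)
    qed
    moreover have "0 < x" if "x \<in># compose_multiset l n E d" for x
      using that d0 E(2) l(2) unfolding set by (cases "x = 0") auto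
    ultimately show "compose_multiset l n E d \<in> distinct_multiples_multisets l n"
      using sm by (simp add: distinct_multiples_multisets_def)
  qed
  show ?thesis
  proof (rule bij_betw_imageI)
    show "inj_on ?f ?A"
    proof (rule inj_onI, clarify)
      fix E d E' d'
      assume *: "finite E" "0 \<notin> E" "l * \<Sum>E \<le> n" "d dvd n - l * \<Sum>E"
        "finite E'" "0 \<notin> E'" "l * \<Sum>E' \<le> n" "d' dvd n - l * \<Sum>E'"
        "compose_multiset l n E d = compose_multiset l n E' d'"
      have "(*) l ` E = (*) l ` E'" using compose_props(2)[OF *(1-4)] compose_props(2)[OF *(5-8)] *(9) by simp
      then have "E = E'" using inj_image_eq_iff[OF inj[of UNIV]] by simp
      moreover have "{d} = {d'}" using compose_props(3)[OF *(1-4)] compose_props(3)[OF *(5-8)] *(9) by simp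
      ultimately show "E = E' \<and> d = d'" by simp
    qed
    show "?f ` ?A = ?B"
    proof (intro equalityI subsetI)
      fix M assume "M \<in> ?f ` ?A"
      then obtain E d where M: "M = compose_multiset l n E d"
        and *: "finite E" "0 \<notin> E" "l * \<Sum>E \<le> n" "d dvd n - l * \<Sum>E" by auto
      show "M \<in> ?B" unfolding M using compose_props(1,3)[OF *] by blast
    next
      fix M assume "M \<in> ?B"
      then obtain d where M: "M \<in> distinct_multiples_multisets l n"
        and d: "{x \<in> set_mset M. \<not> l dvd x} = {d}" by blast
      have cnt: "\<And>x. x \<in># M \<Longrightarrow> l dvd x \<Longrightarrow> count M x = 1" and sm: "sum_mset M = n"
        and pos: "\<And>x. x \<in># M \<Longrightarrow> 0 < x"
        using M by (auto simp: distinct_multiples_multisets_def)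
      define E where "E = {e. l * e \<in># M}"
      have img: "(*) l ` E = {x \<in> set_mset M. l dvd x}" by (auto simp: E_def)
      have finE: "finite E" by (rule finite_imageD[OF _ inj]) (simp add: img)
      have E0: "0 \<notin> E" using pos by (auto simp: E_def)
      have nl: "\<not> l dvd d" and dM: "d \<in># M" using d by auto
      have M_eq: "M = mset_set ((*) l ` E) + replicate_mset (count M d) d"
      proof (rule multiset_eqI)
        fix x
        show "count M x = count (mset_set ((*) l ` E) + replicate_mset (count M d) d) x"
        proof (cases "x \<in># M")
          case True
          show ?thesis
          proof (cases "l dvd x")
            case dvd: True
            then have "x \<in> (*) l ` E" "x \<noteq> d" using img True nl by auto
            then show ?thesis using cnt[OF True dvd] finE by simp
          next
            case False
            then have "x = d" "x \<notin> (*) l ` E" using True d img by blast+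
            then show ?thesis using finE by simp
          qed
        next
          case False
          then have "x \<notin> (*) l ` E" "x \<noteq> d" using img dM by auto
          then show ?thesis using False by (simp add: not_in_iff)
        qed
      qed
      have "n = sum_mset (mset_set ((*) l ` E) + replicate_mset (count M d) d)"
        unfolding M_eq[symmetric] using sm by (rule sym)
      also have "\<dots> = (\<Sum>x\<in>(*) l ` E. x) + count M d * d" by (simp add: sum_unfold_sum_mset)
      also have "(\<Sum>x\<in>(*) l ` E. x) = l * \<Sum>E" by (simp add: sum.reindex[OF inj] sum_distrib_left)
      finally have n: "n = l * \<Sum>E + count M d * d" .
      moreover have "0 < d" using pos dM by blast
      ultimately have "M = compose_multiset l n E d" using M_eq by (simp add: compose_multiset_def)
      moreover have "(E, d) \<in> ?A" using finE E0 n by auto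
      ultimately show "M \<in> ?f ` ?A" by force
    qed
  qed
qed

text \<open>Each \<open>E\<close> contributes the number of divisors of \<open>n - l \<Sum>E\<close>, of which only the parity matters.\<close>

theorem R_star_cong_square:
  assumes l: "\<not> l dvd n" "0 < l"
  shows "[R_star l n = 2 * card {E. finite E \<and> 0 \<notin> E \<and> (\<exists>k. l * \<Sum>E + k ^ 2 = n)}] (mod 4)"
proof -
  let ?I = "{E. finite E \<and> 0 \<notin> E \<and> l * \<Sum>E \<le> n}"
  let ?sq = "\<lambda>E. \<exists>k. l * \<Sum>E + k ^ 2 = n"
  have "?I \<subseteq> (\<Union>s\<le>n. distinct_partitions s)"
  proof
    fix E assume E: "E \<in> ?I"
    have "\<Sum>E \<le> l * \<Sum>E" using l(2) by simp
    also have "\<dots> \<le> n" using E by simp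
    finally show "E \<in> (\<Union>s\<le>n. distinct_partitions s)" using E by (simp add: distinct_partitions_def)
  qed
  then have finI: "finite ?I" by (rule finite_subset) simp
  have pos: "0 < n - l * \<Sum>E" if "l * \<Sum>E \<le> n" for E
    using that l by (metis bot_nat_0.not_eq_extremum diff_is_0_eq dvd_triv_left le_antisym)
  have odd_iff: "odd (card {d. d dvd n - l * \<Sum>E}) \<longleftrightarrow> ?sq E" if "E \<in> ?I" for E
  proof -
    have "l * \<Sum>E + k ^ 2 = n \<longleftrightarrow> k ^ 2 = n - l * \<Sum>E" for k using that by auto
    then show ?thesis using that divisor_count_odd_iff[OF pos[of E]] by simp
  qed
  have count: "card {M \<in> distinct_multiples_multisets l n. \<exists>d. {x \<in> set_mset M. \<not> l dvd x} = {d}}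
      = (\<Sum>E\<in>?I. card {d. d dvd n - l * \<Sum>E})"
    using bij_betw_same_card[OF single_nonmultiple_bij[OF l]] finI pos by (simp add: card_SigmaI)
  have "[(\<Sum>E\<in>?I. card {d. d dvd n - l * \<Sum>E}) = (\<Sum>E\<in>?I. if ?sq E then 1 else 0)] (mod 2)"
  proof (rule cong_sum)
    fix E assume "E \<in> ?I"
    from odd_iff[OF this] show "[card {d. d dvd n - l * \<Sum>E} = (if ?sq E then 1 else 0)] (mod 2)"
      by (cases "?sq E") (simp_all add: cong_def even_iff_mod_2_eq_zero odd_iff_mod_2_eq_one)
  qed
  moreover have "(\<Sum>E\<in>?I. if ?sq E then 1 else 0) = card {E \<in> ?I. ?sq E}"
    using finI by (simp add: sum.If_cases Int_def)
  moreover have "{E \<in> ?I. ?sq E} = {E. finite E \<and> 0 \<notin> E \<and> ?sq E}" by auto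
  ultimately have "[card {M \<in> distinct_multiples_multisets l n. \<exists>d. {x \<in> set_mset M. \<not> l dvd x} = {d}}
      = card {E. finite E \<and> 0 \<notin> E \<and> ?sq E}] (mod 2)"
    unfolding count by (simp only:)
  then have "[2 * card {M \<in> distinct_multiples_multisets l n. \<exists>d. {x \<in> set_mset M. \<not> l dvd x} = {d}}
      = 2 * card {E. finite E \<and> 0 \<notin> E \<and> ?sq E}] (mod 2 * 2)"
    by (simp only: cong_def mult_mod_right[symmetric])
  then show ?thesis using cong_trans[OF R_star_cong_single_nonmultiple[OF l(1)]] by simp
qed

section \<open>Coefficients of the product and of the theta function\<close>

text \<open>Expanding the product gives one term for each set of exponents, with a sign that is irrelevant
  modulo \<open>2\<close>.\<close>

lemma euler_f_1_parity:
  "even (fps_nth (euler_f 1) k - int (card (distinct_partitions k)))"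
proof -
  obtain n where n: "k \<le> n" "fps_nth (euler_f 1) k = fps_nth (\<Prod>m\<in>{1..n}. 1 - fps_X ^ m :: int fps) k"
    using fps_nth_euler_f_1 by blast
  have "(\<Prod>m\<in>{1..n}. 1 - fps_X ^ m :: int fps) = (\<Prod>m\<in>{1..n}. - (fps_X ^ m) + 1)"
    by simp
  also have "\<dots> = (\<Sum>E\<in>Pow {1..n}. (- 1) ^ card E * fps_X ^ \<Sum>E)"
    by (simp only: prod_add[OF finite_atLeastAtMost] prod_uminus prod.neutral_const mult_1_right power_sum)
  finally have "even (fps_nth (euler_f 1) k - int (card {E \<in> Pow {1..n}. \<Sum>E = k}))"
    using fps_nth_sign_sum_parity[of "Pow {1..n}" card "\<lambda>E. \<Sum>E" k] n(2) by simp
  moreover have "{E \<in> Pow {1..n}. \<Sum>E = k} = distinct_partitions k"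
  proof (intro equalityI subsetI)
    fix E assume E: "E \<in> {E \<in> Pow {1..n}. \<Sum>E = k}"
    then have sub: "E \<subseteq> {1..n}" by simp
    then have "finite E" by (rule finite_subset) simp
    moreover have "0 \<notin> E" using sub by auto
    ultimately show "E \<in> distinct_partitions k" using E by (simp add: distinct_partitions_def)
  next
    fix E assume E: "E \<in> distinct_partitions k"
    then have "E \<subseteq> {1..k}" using distinct_partitions_subset by blast
    also have "\<dots> \<subseteq> {1..n}" using n(1) by simp
    finally show "E \<in> {E \<in> Pow {1..n}. \<Sum>E = k}" using E by (simp add: distinct_partitions_def)
  qed
  ultimately show ?thesis by (simp only:)
qed

text \<open>Pronic numbers are the exponents of \<open>\<psi>(q\<^sup>2)\<close>.\<close>

definition pronic :: "nat \<Rightarrow> bool" where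
  "pronic i \<longleftrightarrow> (\<exists>\<nu>. i = \<nu> * (\<nu> + 1))"

lemma fps_nth_ramanujan_psi:
  "fps_nth ramanujan_psi k = of_bool (\<exists>\<nu>. k = \<nu> * (\<nu> + 1) div 2)"
proof -
  let ?t = "\<lambda>\<nu>::nat. \<nu> * (\<nu> + 1) div 2"
  have mono: "strict_mono ?t"
    by (rule strict_monoI_Suc) (simp only: triangular_Suc less_add_same_cancel1 zero_less_Suc)
  have "(\<lambda>n. \<Sum>\<nu><n. fps_X ^ ?t \<nu> :: int fps) \<longlonglongrightarrow> ramanujan_psi"
    using ramanujan_psi_sums by (simp add: sums_def)
  then obtain n0 where n0: "\<And>n. n \<ge> n0 \<Longrightarrow>
      fps_nth (\<Sum>\<nu><n. fps_X ^ ?t \<nu> :: int fps) k = fps_nth ramanujan_psi k"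
    unfolding tendsto_fps_iff eventually_sequentially by blast
  let ?n = "max n0 (Suc k)"
  have "fps_nth ramanujan_psi k = (\<Sum>\<nu><?n. if k = ?t \<nu> then 1 else 0)"
    using n0[of ?n] by (simp add: fps_sum_nth fps_X_power_nth)
  also have "\<dots> = int (card {\<nu> \<in> {..<?n}. k = ?t \<nu>})"
    by (simp add: sum.If_cases Int_def)
  also have "\<dots> = int (card {\<nu>. k = ?t \<nu>})"
  proof -
    have "\<nu> < ?n" if "k = ?t \<nu>" for \<nu>
      using strict_mono_imp_increasing[OF mono, of \<nu>] unfolding that[symmetric] by simp
    then have "{\<nu> \<in> {..<?n}. k = ?t \<nu>} = {\<nu>. k = ?t \<nu>}" by blast
    then show ?thesis by (simp only:)
  qed
  also have "int (card {\<nu>. k = ?t \<nu>}) = of_bool (\<exists>\<nu>. k = ?t \<nu>)"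
  proof (cases "\<exists>\<nu>. k = ?t \<nu>")
    case True
    then obtain \<nu> where \<nu>: "k = ?t \<nu>" by blast
    then have "{\<nu>. k = ?t \<nu>} = {\<nu>}" using strict_mono_eq[OF mono] by auto
    then have "card {\<nu>. k = ?t \<nu>} = 1" by simp
    then show ?thesis using True by simp
  qed simp
  finally show ?thesis .
qed

lemma fps_nth_psi_square:
  "fps_nth (fps_compose ramanujan_psi (fps_X ^ 2)) i = of_bool (pronic i)"
proof -
  have "2 dvd i \<and> (\<exists>\<nu>. i div 2 = \<nu> * (\<nu> + 1) div 2) \<longleftrightarrow> pronic i"
  proof
    assume "2 dvd i \<and> (\<exists>\<nu>. i div 2 = \<nu> * (\<nu> + 1) div 2)"
    then obtain \<nu> where "2 dvd i" "i div 2 = \<nu> * (\<nu> + 1) div 2" by blast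
    moreover have "even (\<nu> * (\<nu> + 1))" by simp
    ultimately have "i = \<nu> * (\<nu> + 1)" by (metis dvd_mult_div_cancel)
    then show "pronic i" by (auto simp: pronic_def)
  qed (auto simp: pronic_def)
  then show ?thesis by (auto simp: fps_nth_compose_X_power fps_nth_ramanujan_psi)
qed

definition f1_psi_coeff :: "nat \<Rightarrow> int" where
  "f1_psi_coeff m = fps_nth (euler_f 1 * fps_compose ramanujan_psi (fps_X ^ 2)) m"

lemma f1_psi_coeff_eq: "f1_psi_coeff m = (\<Sum>i\<in>{i \<in> {..m}. pronic i}. fps_nth (euler_f 1) (m - i))"
proof -
  have "f1_psi_coeff m = (\<Sum>i\<le>m. if pronic i then fps_nth (euler_f 1) (m - i) else 0)"
    unfolding f1_psi_coeff_def mult.commute[of "euler_f 1"] fps_mult_nth fps_nth_psi_square atLeast0AtMost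
    by (intro sum.cong) auto
  also have "\<dots> = (\<Sum>i\<in>{i \<in> {..m}. pronic i}. fps_nth (euler_f 1) (m - i))"
    by (rule sum.inter_filter[symmetric]) simp
  finally show ?thesis .
qed

section \<open>Representations by the form \<open>x\<^sup>2 + 6 y\<^sup>2\<close>\<close>

definition rep_count :: "nat \<Rightarrow> nat" where
  "rep_count t = card {(x::nat, y::nat). x ^ 2 + 6 * y ^ 2 = t}"

lemma norm_form_second_odd:
  fixes x y m :: nat
  assumes "x ^ 2 + 6 * y ^ 2 = 24 * m + 7"
  shows "odd y"
proof
  assume "even y"
  then obtain z where "y = 2 * z" by blast
  then have "x ^ 2 + 24 * z ^ 2 = 24 * m + 7" using assms by (simp add: power_mult_distrib)
  then have "x ^ 2 mod 4 = 3" by presburger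
  then have "(x mod 4) ^ 2 mod 4 = 3" by (simp add: power_mod)
  moreover have "x mod 4 \<in> {0, 1, 2, 3}" by auto
  ultimately show False by auto
qed

text \<open>The substitution \<open>i = (y\<^sup>2 - 1) / 4 = \<nu> (\<nu> + 1)\<close> with \<open>y = 2 \<nu> + 1\<close> turns a representation of \<open>24 m + 7\<close>
  into an exponent \<open>i\<close> occurring in \<open>\<psi>(q\<^sup>2)\<close> such that \<open>24 (m - i) + 1 = x\<^sup>2\<close>, that is, such that the coefficient
  of \<open>f\<^sub>1\<close> at \<open>m - i\<close> is odd. It is reversible since \<open>y\<close> is automatically odd.\<close>

lemma f1_psi_coeff_parity: "even (f1_psi_coeff m - int (rep_count (24 * m + 7)))"
proof -
  let ?P = "{i \<in> {..m}. pronic i}" and ?sq = "\<lambda>k. \<exists>x::nat. x ^ 2 = 24 * k + 1"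
  let ?R = "{(x::nat, y::nat). x ^ 2 + 6 * y ^ 2 = 24 * m + 7}"
  have "bij_betw (\<lambda>(x, y). (y ^ 2 - 1) div 4) ?R {i \<in> ?P. ?sq (m - i)}"
  proof (rule bij_betw_imageI)
    have val: "\<exists>\<nu>. y = 2 * \<nu> + 1 \<and> (y ^ 2 - 1) div 4 = \<nu> * (\<nu> + 1) \<and> x ^ 2 + 24 * (\<nu> * (\<nu> + 1)) = 24 * m + 1"
      if eq: "x ^ 2 + 6 * y ^ 2 = 24 * m + 7" for x y
    proof -
      obtain \<nu> where \<nu>: "y = 2 * \<nu> + 1" using norm_form_second_odd[OF eq] by (elim oddE)
      then have "y ^ 2 = 4 * (\<nu> * (\<nu> + 1)) + 1" by (simp add: power2_eq_square algebra_simps)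
      with \<nu> eq show ?thesis by auto
    qed
    show "inj_on (\<lambda>(x, y). (y ^ 2 - 1) div 4) ?R"
    proof (rule inj_onI, clarify)
      fix x y x' y' :: nat
      assume *: "x ^ 2 + 6 * y ^ 2 = 24 * m + 7" "x' ^ 2 + 6 * y' ^ 2 = 24 * m + 7"
        "(y ^ 2 - 1) div 4 = (y' ^ 2 - 1) div 4"
      obtain \<nu> \<nu>' where v: "y = 2 * \<nu> + 1" "(y ^ 2 - 1) div 4 = \<nu> * (\<nu> + 1)" "y' = 2 * \<nu>' + 1"
        "(y' ^ 2 - 1) div 4 = \<nu>' * (\<nu>' + 1)" using val[OF *(1)] val[OF *(2)] by blast
      then have y: "y ^ 2 = y' ^ 2" using *(3) by (simp add: power2_eq_square algebra_simps)
      then have "x ^ 2 = x' ^ 2" using *(1,2) by linarith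
      then have "x = x'" by simp
      moreover from y have "y = y'" by simp
      ultimately show "x = x' \<and> y = y'" ..
    qed
    show "(\<lambda>(x, y). (y ^ 2 - 1) div 4) ` ?R = {i \<in> ?P. ?sq (m - i)}"
    proof (intro equalityI subsetI)
      fix i assume "i \<in> (\<lambda>(x, y). (y ^ 2 - 1) div 4) ` ?R"
      then obtain x y where xy: "x ^ 2 + 6 * y ^ 2 = 24 * m + 7" "i = (y ^ 2 - 1) div 4" by auto
      then obtain \<nu> where \<nu>: "i = \<nu> * (\<nu> + 1)" "x ^ 2 + 24 * i = 24 * m + 1" using val[OF xy(1)] by auto
      then have "i \<le> m" by linarith
      moreover from this have "x ^ 2 = 24 * (m - i) + 1"
        using \<nu>(2) unfolding diff_mult_distrib2 by linarith
      ultimately show "i \<in> {i \<in> ?P. ?sq (m - i)}" using \<nu>(1) by (auto simp: pronic_def)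
    next
      fix i assume "i \<in> {i \<in> ?P. ?sq (m - i)}"
      then obtain \<nu> x where i: "i \<le> m" "i = \<nu> * (\<nu> + 1)" "x ^ 2 = 24 * (m - i) + 1"
        by (auto simp: pronic_def)
      have y: "(2 * \<nu> + 1) ^ 2 = 4 * i + 1" unfolding i(2) by (simp add: power2_eq_square algebra_simps)
      have "x ^ 2 + 6 * (2 * \<nu> + 1) ^ 2 = 24 * m + 7" unfolding y i(3) using i(1) by simp
      moreover have "i = ((2 * \<nu> + 1) ^ 2 - 1) div 4" unfolding y by simp
      ultimately show "i \<in> (\<lambda>(x, y). (y ^ 2 - 1) div 4) ` ?R"
        by (intro image_eqI[of _ _ "(x, 2 * \<nu> + 1)"]) auto
    qed
  qed
  then have "rep_count (24 * m + 7) = card {i \<in> ?P. ?sq (m - i)}"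
    unfolding rep_count_def by (rule bij_betw_same_card)
  also have "\<dots> = (\<Sum>i\<in>?P. if ?sq (m - i) then 1 else 0)"
    by (simp add: sum.If_cases Int_def)
  finally have count: "rep_count (24 * m + 7) = (\<Sum>i\<in>?P. if ?sq (m - i) then 1 else 0)" .
  have "f1_psi_coeff m - int (rep_count (24 * m + 7))
      = (\<Sum>i\<in>?P. fps_nth (euler_f 1) (m - i) - (if ?sq (m - i) then 1 else 0))"
    unfolding count f1_psi_coeff_eq sum_subtractf of_nat_sum by (simp add: of_bool_def[symmetric])
  also have "even \<dots>"
    using euler_f_1_odd_iff by (intro dvd_sum) auto
  finally show ?thesis .
qed

text \<open>If \<open>p\<close> did not divide \<open>y\<close>, then \<open>x / y\<close> would be a square root of \<open>- 6\<close> modulo \<open>p\<close>.\<close>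

lemma prime_dvd_norm_form:
  fixes x y p :: nat
  assumes p: "prime p" and L: "Legendre (- 6) (int p) = - 1" and dvd: "p dvd x ^ 2 + 6 * y ^ 2"
  shows "p dvd x \<and> p dvd y"
proof -
  have nonres: "\<not> QuadRes (int p) (- 6)" using L by (auto simp: Legendre_def split: if_splits)
  have "p dvd y"
  proof (rule ccontr)
    assume "\<not> p dvd y"
    then have "coprime (int y) (int p)" using p by (simp add: coprime_commute prime_imp_coprime_nat)
    then obtain z where z: "[int y * z = 1] (mod int p)" using cong_solve_coprime_int by blast
    have "[int x ^ 2 = - 6 * int y ^ 2] (mod int p)"
    proof -
      have "int p dvd int (x ^ 2 + 6 * y ^ 2)" using dvd by (simp only: of_nat_dvd_iff)
      then show ?thesis by (simp add: cong_iff_dvd_diff)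
    qed
    then have "[int x ^ 2 * z ^ 2 = - 6 * int y ^ 2 * z ^ 2] (mod int p)" by (rule cong_scalar_right)
    then have "[(int x * z) ^ 2 = - 6 * (int y * z) ^ 2] (mod int p)" by (simp add: power_mult_distrib mult.assoc)
    also have "[- 6 * (int y * z) ^ 2 = - 6 * 1 ^ 2] (mod int p)"
      by (intro cong_scalar_left cong_pow z)
    finally have "QuadRes (int p) (- 6)" by (auto simp: QuadRes_def)
    with nonres show False ..
  qed
  moreover from this have "p dvd x"
  proof -
    have "p dvd 6 * y ^ 2" using \<open>p dvd y\<close> by (simp add: power2_eq_square)
    with dvd have "p dvd x ^ 2" by (simp add: dvd_add_left_iff)
    with p show ?thesis by (rule prime_dvd_power)
  qed
  ultimately show ?thesis by simp
qed

text \<open>Scaling a representation by \<open>p\<close> is injective, and it reaches every representation of \<open>p\<^sup>2 t\<close> because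
  both coordinates of such a representation are divisible by \<open>p\<close>.\<close>

lemma rep_count_mult_square:
  assumes p: "prime p" and L: "Legendre (- 6) (int p) = - 1"
  shows "rep_count (p ^ 2 * t) = rep_count t"
proof -
  have p0: "0 < p" using p by (rule prime_gt_0_nat)
  have scale: "(p * x) ^ 2 + 6 * (p * y) ^ 2 = p ^ 2 * (x ^ 2 + 6 * y ^ 2)" for x y
    by (simp add: power_mult_distrib algebra_simps)
  have "bij_betw (\<lambda>(x, y). (p * x, p * y)) {(x, y). x ^ 2 + 6 * y ^ 2 = t} {(x, y). x ^ 2 + 6 * y ^ 2 = p ^ 2 * t}"
  proof (rule bij_betw_imageI)
    show "inj_on (\<lambda>(x, y). (p * x, p * y)) {(x, y). x ^ 2 + 6 * y ^ 2 = t}"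
      using p0 by (auto simp: inj_on_def)
    show "(\<lambda>(x, y). (p * x, p * y)) ` {(x, y). x ^ 2 + 6 * y ^ 2 = t} = {(x, y). x ^ 2 + 6 * y ^ 2 = p ^ 2 * t}"
    proof (intro equalityI subsetI)
      fix w assume "w \<in> {(x, y). x ^ 2 + 6 * y ^ 2 = p ^ 2 * t}"
      then obtain x y where w: "w = (x, y)" "x ^ 2 + 6 * y ^ 2 = p ^ 2 * t" by auto
      then have "p dvd x ^ 2 + 6 * y ^ 2" by (simp add: power2_eq_square)
      then obtain x' y' where xy: "x = p * x'" "y = p * y'" using prime_dvd_norm_form[OF p L] by blast
      then have "x' ^ 2 + 6 * y' ^ 2 = t" using w(2) p0 unfolding xy scale by simp
      then show "w \<in> (\<lambda>(x, y). (p * x, p * y)) ` {(x, y). x ^ 2 + 6 * y ^ 2 = t}"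
        using w(1) xy by auto
    qed (auto simp: scale)
  qed
  then show ?thesis unfolding rep_count_def using bij_betw_same_card by metis
qed

lemma rep_count_mult_even_power:
  assumes "prime p" "Legendre (- 6) (int p) = - 1"
  shows "rep_count (p ^ (2 * k) * t) = rep_count t"
proof (induction k)
  case (Suc k)
  have "p ^ (2 * Suc k) * t = p ^ 2 * (p ^ (2 * k) * t)" by (simp add: power2_eq_square)
  then show ?case using rep_count_mult_square[OF assms] Suc.IH by metis
qed simp

lemma rep_count_eq_0:
  assumes "prime p" "Legendre (- 6) (int p) = - 1" "p dvd t" "\<not> p ^ 2 dvd t"
  shows "rep_count t = 0"
proof -
  have "x ^ 2 + 6 * y ^ 2 \<noteq> t" for x y
  proof
    assume t: "x ^ 2 + 6 * y ^ 2 = t"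
    then have "p dvd x" "p dvd y" using prime_dvd_norm_form[OF assms(1,2)] assms(3) by blast+
    then have "p ^ 2 dvd x ^ 2 + 6 * y ^ 2" by (simp add: dvd_power_same)
    with t assms(4) show False by simp
  qed
  then show ?thesis by (simp add: rep_count_def)
qed

section \<open>Overpartition counts in residue classes modulo 4\<close>

lemma double_cong_mod_4:
  fixes a b :: int
  assumes "even (b - a)"
  shows "[2 * a = 2 * b] (mod 4)"
  using assms unfolding cong_iff_dvd_diff by presburger

text \<open>A square \<open>4 m + 1 - 4 s\<close> is the square of some \<open>2 \<nu> + 1\<close>, so that \<open>s = m - \<nu> (\<nu> + 1)\<close>: the sets \<open>E\<close> in
  \<open>R_star_cong_square\<close> are the distinct partitions of the numbers \<open>m - \<nu> (\<nu> + 1)\<close>.\<close>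

lemma R_star_4_residue_1:
  "[int (R_star 4 (4 * m + 1)) = 2 * f1_psi_coeff m] (mod 4)"
proof -
  let ?P = "{i \<in> {..m}. pronic i}"
  have square_iff: "(\<exists>k. 4 * s + k ^ 2 = 4 * m + 1) \<longleftrightarrow> s \<le> m \<and> pronic (m - s)" for s
  proof
    assume "\<exists>k. 4 * s + k ^ 2 = 4 * m + 1"
    then obtain k where k: "4 * s + k ^ 2 = 4 * m + 1" by blast
    then have "odd (k ^ 2)" by presburger
    then have "odd k" by simp
    then obtain \<nu> where \<nu>: "k = 2 * \<nu> + 1" by (elim oddE)
    then have "s + \<nu> * (\<nu> + 1) = m" using k by (simp add: power2_eq_square algebra_simps)
    then show "s \<le> m \<and> pronic (m - s)" by (auto simp: pronic_def)
  next
    assume "s \<le> m \<and> pronic (m - s)"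
    then obtain \<nu> where "m = s + \<nu> * (\<nu> + 1)" by (metis pronic_def le_add_diff_inverse)
    then have "4 * s + (2 * \<nu> + 1) ^ 2 = 4 * m + 1" by (simp add: power2_eq_square algebra_simps)
    then show "\<exists>k. 4 * s + k ^ 2 = 4 * m + 1" by blast
  qed
  have union: "{E. finite E \<and> 0 \<notin> E \<and> (\<exists>k. 4 * \<Sum>E + k ^ 2 = 4 * m + 1)} = (\<Union>i\<in>?P. distinct_partitions (m - i))"
    unfolding square_iff distinct_partitions_def
  proof (intro equalityI subsetI)
    fix E assume "E \<in> {E. finite E \<and> 0 \<notin> E \<and> \<Sum>E \<le> m \<and> pronic (m - \<Sum>E)}"
    then show "E \<in> (\<Union>i\<in>?P. {E. finite E \<and> 0 \<notin> E \<and> \<Sum>E = m - i})"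
      by (intro UN_I[of "m - \<Sum>E"]) auto
  qed auto
  have card: "card {E. finite E \<and> 0 \<notin> E \<and> (\<exists>k. 4 * \<Sum>E + k ^ 2 = 4 * m + 1)}
      = (\<Sum>i\<in>?P. card (distinct_partitions (m - i)))"
    unfolding union by (rule card_UN_disjoint, simp, simp) (auto simp: distinct_partitions_def)
  have "\<not> 4 dvd 4 * m + 1" by presburger
  from R_star_cong_square[OF this]
  have "[int (R_star 4 (4 * m + 1)) = int (2 * (\<Sum>i\<in>?P. card (distinct_partitions (m - i))))] (mod int 4)"
    unfolding card[symmetric] cong_int_iff by simp
  then have "[int (R_star 4 (4 * m + 1)) = 2 * int (\<Sum>i\<in>?P. card (distinct_partitions (m - i)))] (mod 4)"
    by simp
  moreover have "even (f1_psi_coeff m - int (\<Sum>i\<in>?P. card (distinct_partitions (m - i))))"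
    unfolding f1_psi_coeff_eq of_nat_sum sum_subtractf[symmetric] by (intro dvd_sum euler_f_1_parity)
  then have "[2 * int (\<Sum>i\<in>?P. card (distinct_partitions (m - i))) = 2 * f1_psi_coeff m] (mod 4)"
    by (rule double_cong_mod_4)
  ultimately show ?thesis by (rule cong_trans)
qed

text \<open>No square is \<open>2\<close> or \<open>3\<close> modulo \<open>4\<close>, so the set of \<open>E\<close> in \<open>R_star_cong_square\<close> is empty.\<close>

lemma R_star_4_residue_23:
  assumes "\<xi> \<in> {2, 3}"
  shows "[R_star 4 (4 * n + \<xi>) = 0] (mod 4)"
proof -
  have "4 * s + k ^ 2 \<noteq> 4 * n + \<xi>" for s k :: nat
  proof
    assume "4 * s + k ^ 2 = 4 * n + \<xi>"
    then have "(4 * s + k ^ 2) mod 4 = (4 * n + \<xi>) mod 4" by (simp only:)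
    then have "k ^ 2 mod 4 = \<xi>" using assms by auto
    then have "(k mod 4) ^ 2 mod 4 = \<xi>" by (simp add: power_mod)
    moreover have "k mod 4 \<in> {0, 1, 2, 3}" by auto
    ultimately show False using assms by auto
  qed
  then have none: "{E. finite E \<and> 0 \<notin> E \<and> (\<exists>k. 4 * \<Sum>E + k ^ 2 = 4 * n + \<xi>)} = {}" by blast
  have "\<not> 4 dvd 4 * n + \<xi>" using assms by (auto simp: dvd_add_right_iff simp del: add_2_eq_Suc')
  from R_star_cong_square[OF this] show ?thesis unfolding none by simp
qed

lemma R_star_4_cong_rep_count:
  "[int (R_star 4 (4 * m + 1)) = 2 * int (rep_count (24 * m + 7))] (mod 4)"
proof -
  have "even (f1_psi_coeff m - int (rep_count (24 * m + 7)))" by (rule f1_psi_coeff_parity)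
  then have "[2 * f1_psi_coeff m = 2 * int (rep_count (24 * m + 7))] (mod 4)"
    by (intro double_cong_mod_4) simp
  with R_star_4_residue_1 show ?thesis by (rule cong_trans)
qed

text \<open>The square of a number prime to \<open>6\<close> is \<open>1\<close> both modulo \<open>8\<close> and modulo \<open>3\<close>.\<close>

lemma prime_even_power_mod_24:
  fixes p :: nat
  assumes "prime p" "5 \<le> p"
  obtains c where "p ^ (2 * k) = 24 * c + 1"
proof -
  have "\<not> 2 dvd p" "\<not> 3 dvd p"
    using assms primes_dvd_imp_eq[of 2 p] primes_dvd_imp_eq[of 3 p] by auto
  then have "p mod 8 = 1 \<or> p mod 8 = 3 \<or> p mod 8 = 5 \<or> p mod 8 = 7" "p mod 3 = 1 \<or> p mod 3 = 2"
    by presburger+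
  then have "(p mod 8) ^ 2 mod 8 = 1" "(p mod 3) ^ 2 mod 3 = 1" by auto
  then have "p ^ 2 mod 8 = 1" "p ^ 2 mod 3 = 1" by (simp_all add: power_mod)
  then have "[p ^ 2 = 1] (mod 8)" "[p ^ 2 = 1] (mod 3)" by (simp_all add: cong_def)
  moreover have "coprime 8 (3::nat)" by (simp add: coprime_iff_gcd_eq_1 gcd_non_0_nat)
  ultimately have "[p ^ 2 = 1] (mod 8 * 3)" by (rule coprime_cong_mult_nat)
  then have "[p ^ 2 = 1] (mod 24)" by simp
  then have "[(p ^ 2) ^ k = 1 ^ k] (mod 24)" by (rule cong_pow)
  then have "(p ^ 2) ^ k mod 24 = 1" by (simp add: cong_def)
  then have "p ^ (2 * k) = 24 * (p ^ (2 * k) div 24) + 1"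
    unfolding power_mult using mult_div_mod_eq[of 24 "(p ^ 2) ^ k"] by simp
  then show thesis by (rule that)
qed

text \<open>With \<open>p\<^bsup>2 k\<^esup> = 24 c + 1\<close> the argument is \<open>4 M + 1\<close> for \<open>M = p\<^bsup>2 k\<^esup> m + 7 c\<close>, and then
  \<open>24 M + 7 = p\<^bsup>2 k\<^esup> (24 m + 7)\<close>.\<close>

lemma R_star_4_scaled_cong:
  assumes p: "prime p" "5 \<le> p" and L: "Legendre (- 6) (int p) = - 1"
  shows "[int (R_star 4 (4 * p ^ (2 * k) * m + (7 * p ^ (2 * k) - 1) div 6)) = 2 * f1_psi_coeff m] (mod 4)"
proof -
  obtain c where c: "p ^ (2 * k) = 24 * c + 1" using prime_even_power_mod_24[OF p] .
  let ?M = "p ^ (2 * k) * m + 7 * c"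
  have "4 * p ^ (2 * k) * m + (7 * p ^ (2 * k) - 1) div 6 = 4 * ?M + 1"
    unfolding c by (simp add: algebra_simps)
  moreover have form: "24 * ?M + 7 = p ^ (2 * k) * (24 * m + 7)"
    unfolding c by (simp add: algebra_simps)
  ultimately have scaled: "[int (R_star 4 (4 * p ^ (2 * k) * m + (7 * p ^ (2 * k) - 1) div 6))
      = 2 * int (rep_count (24 * m + 7))] (mod 4)"
    using R_star_4_cong_rep_count[of ?M] unfolding form rep_count_mult_even_power[OF p(1) L]
    by (simp only:)
  have parity: "[2 * f1_psi_coeff m = 2 * int (rep_count (24 * m + 7))] (mod 4)"
    using f1_psi_coeff_parity[of m] by (intro double_cong_mod_4) simp
  from scaled cong_sym[OF parity] show ?thesis by (rule cong_trans)
qed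

text \<open>The argument is again some \<open>4 M + 1\<close>, and now \<open>p\<^bsup>2 k + 1\<^esup>\<close> is the exact power of \<open>p\<close> dividing \<open>24 M + 7\<close>,
  because \<open>p\<close> does not divide \<open>24 r\<close>.\<close>

lemma R_star_4_odd_power_cong:
  assumes p: "prime p" "5 \<le> p" and L: "Legendre (- 6) (int p) = - 1" and r: "1 \<le> r" "r \<le> p - 1"
  shows "[R_star 4 (4 * p ^ (2 * k + 1) * (p * n + r) + (7 * p ^ (2 * k + 2) - 1) div 6) = 0] (mod 4)"
proof -
  have "p ^ (2 * (k + 1)) = p ^ (2 * k + 2)" by (simp add: power_add)
  then obtain c where c: "p ^ (2 * k + 2) = 24 * c + 1"
    using prime_even_power_mod_24[OF p, of "k + 1"] by metis
  let ?M = "p ^ (2 * k + 1) * (p * n + r) + 7 * c"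
  let ?t = "p * (24 * (p * n + r) + 7 * p)"
  have arg: "4 * p ^ (2 * k + 1) * (p * n + r) + (7 * p ^ (2 * k + 2) - 1) div 6 = 4 * ?M + 1"
    unfolding c by simp
  have "24 * ?M + 7 = 24 * (p ^ (2 * k + 1) * (p * n + r)) + 7 * p ^ (2 * k + 2)"
    unfolding c by simp
  also have "\<dots> = p ^ (2 * k) * ?t" by (simp add: algebra_simps power2_eq_square)
  finally have form: "24 * ?M + 7 = p ^ (2 * k) * ?t" .
  have "\<not> p dvd 24 * r"
  proof
    assume "p dvd 24 * r"
    moreover have "\<not> p dvd r" using r by (auto dest: dvd_imp_le)
    ultimately have "p dvd 2 ^ 3 * 3" using p(1) by (simp add: prime_dvd_mult_iff)
    then have "p dvd 2 \<or> p dvd 3" using p(1) prime_dvd_mult_iff prime_dvd_power by blast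
    then show False using p(2) by (auto dest: dvd_imp_le)
  qed
  moreover have "24 * (p * n + r) + 7 * p = 24 * r + p * (24 * n + 7)" by (simp add: algebra_simps)
  ultimately have "\<not> p dvd 24 * (p * n + r) + 7 * p" by (metis dvd_add_left_iff dvd_triv_left)
  then have "\<not> p ^ 2 dvd ?t" using p(2) by (simp add: power2_eq_square)
  then have "rep_count (24 * ?M + 7) = 0"
    unfolding form rep_count_mult_even_power[OF p(1) L] using p(1) L by (intro rep_count_eq_0) auto
  then have "[int (R_star 4 (4 * ?M + 1)) = int 0] (mod int 4)"
    using R_star_4_cong_rep_count[of ?M] by simp
  then show ?thesis unfolding arg cong_int_iff .
qed

theorem theorem3p1:
  shows "(\<forall>n::nat. \<forall>\<xi>\<in>{2, 3::nat}. [R_star 4 (4 * n + \<xi>) = 0] (mod 4)) \<and>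
    (\<forall>(p::nat) (r::nat).
      prime p \<and> 13 \<le> p \<and> Legendre (- 6) (int p) = - 1 \<and> 1 \<le> r \<and> r \<le> p - 1 \<longrightarrow>
      (\<forall>(\<alpha>::nat) (n::nat).
        fps_cong
          (Abs_fps (\<lambda>m. int (R_star 4 (4 * p ^ (2 * \<alpha>) * m + (7 * p ^ (2 * \<alpha>) - 1) div 6))))
          (2 * euler_f 1 * fps_compose ramanujan_psi (fps_X ^ 2)) 4 \<and>
        [R_star 4 (4 * p ^ (2 * \<alpha> + 1) * (p * n + r) + (7 * p ^ (2 * \<alpha> + 2) - 1) div 6) = 0]
          (mod 4)))"
proof (intro conjI allI ballI impI; (elim conjE)?)
  fix n \<xi> :: nat
  assume "\<xi> \<in> {2, 3}"
  then show "[R_star 4 (4 * n + \<xi>) = 0] (mod 4)" by (rule R_star_4_residue_23)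
next
  fix p r \<alpha> n :: nat
  assume p: "prime p" "13 \<le> p" "Legendre (- 6) (int p) = - 1" and r: "1 \<le> r" "r \<le> p - 1"
  then have p5: "5 \<le> p" by simp
  have "fps_nth (2 * euler_f 1 * fps_compose ramanujan_psi (fps_X ^ 2)) m = 2 * f1_psi_coeff m" for m
    unfolding f1_psi_coeff_def mult.assoc by (simp only: mult_2 fps_add_nth)
  then show "fps_cong
      (Abs_fps (\<lambda>m. int (R_star 4 (4 * p ^ (2 * \<alpha>) * m + (7 * p ^ (2 * \<alpha>) - 1) div 6))))
      (2 * euler_f 1 * fps_compose ramanujan_psi (fps_X ^ 2)) 4"
    using R_star_4_scaled_cong[OF p(1) p5 p(3)] by (simp add: fps_cong_def)
  show "[R_star 4 (4 * p ^ (2 * \<alpha> + 1) * (p * n + r) + (7 * p ^ (2 * \<alpha> + 2) - 1) div 6) = 0] (mod 4)"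
    by (rule R_star_4_odd_power_cong[OF p(1) p5 p(3) r])
qed

end
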